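(* Let $\nu_0=\sqrt{1-\sin^2 1}$ and $\nu_1=-\dfrac{\sin 2}{1+\cos 2}$. Let $\beta_1,\beta_2>0$ be real numbers with $\nu_0(\beta_1+\beta_2\nu_1)\geq r_0$, where $r_0\approx 0.546302$ is the positive root of the equation $r^2+2\cot(1)\,r-1=0$. Let $p$ be an analytic function in $\mathbb{D}$ with $p(0)=1$ and $$1+\beta_1 zp'(z)+\beta_2 z^2p''(z)\prec \frac{2}{1+e^{-z}}.$$ Then $p(z)\prec 1+\sin z$.
   Context: $\mathbb{D}=\{z\in\mathbb{C}:|z|<1\}$. For functions $f,g$ analytic in $\mathbb{D}$, $f\prec g$ ($f$ is subordinate to $g$) means there is an analytic $w:\mathbb{D}\to\mathbb{C}$ with $w(0)=0$ and $|w(z)|\leq|z|$ such that $f(z)=g(w(z))$ for all $z\in\mathbb{D}$. Numerically $\nu_0\approx 0.540302$, $\nu_1\approx -1.55741$. *)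

theory Defs
  imports "HOL-Complex_Analysis.Complex_Analysis"
begin

text \<open>Subordination of functions on the open unit disc. Since the modulus of \<open>w z\<close> is at most that of
  \<open>z\<close>, the function \<open>w\<close> maps the disc into itself. Analyticity of \<open>f\<close> and \<open>g\<close> is not part of the
  relation; it is meant to be used only for functions analytic in the disc.\<close>

definition subordinate :: "(complex \<Rightarrow> complex) \<Rightarrow> (complex \<Rightarrow> complex) \<Rightarrow> bool"
  where "subordinate f g \<longleftrightarrow>
    (\<exists>w. w analytic_on ball 0 1 \<and> w 0 = 0 \<and>
         (\<forall>z\<in>ball 0 1. norm (w z) \<le> norm z) \<and>
         (\<forall>z\<in>ball 0 1. f z = g (w z)))"

end

theory Submission imports Defs begin

text \<open>The numbers are explicit: \<open>r0 = tan (1/2)\<close> and \<open>\<nu>0 = cos 1\<close>, and \<open>\<nu>1 < 0\<close>, so the hypothesis gives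
  \<open>tan (1/2) / \<beta>1 \<le> cos 1\<close>. The target of the subordination hypothesis is \<open>1 + tanh (z/2)\<close>, and
  \<open>\<bar>tanh (w/2)\<bar> \<le> tan (1/2) \<bar>w\<bar>\<close> in the disc, whence
  \<open>\<bar>\<beta>1 p' + \<beta>2 z p''\<bar> \<le> tan (1/2)\<close>. Integrating this first-order equation for \<open>p'\<close> along radii yields
  \<open>\<bar>p'\<bar> \<le> tan (1/2) / \<beta>1 \<le> cos 1\<close>, hence \<open>\<bar>p - 1\<bar> \<le> cos 1 \<bar>z\<bar>\<close>. Then \<open>w = arcsin (p - 1)\<close> is defined and
  \<open>\<bar>w\<bar> \<le> arcsin (cos 1) = \<pi>/2 - 1 < 1\<close>, and the Schwarz lemma gives \<open>\<bar>w z\<bar> \<le> \<bar>z\<bar>\<close>.\<close>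

text \<open>Mean value inequality along the segment from 0 to \<open>z\<close>, parametrised by the
  modulus. The derivative bound is asked only off 0, which covers the interior of the segment; the
  later bound on \<open>deriv p\<close> is obtained only there.\<close>

lemma norm_diff_le_radial_majorant:
  fixes f :: "complex \<Rightarrow> complex" and g :: "real \<Rightarrow> real"
  assumes f: "\<And>z. norm z < R \<Longrightarrow> (f has_field_derivative f' z) (at z)"
    and g: "\<And>t. 0 \<le> t \<Longrightarrow> t < R \<Longrightarrow> (g has_real_derivative g' t) (at t)"
    and le: "\<And>z. z \<noteq> 0 \<Longrightarrow> norm z < R \<Longrightarrow> norm (f' z) \<le> g' (norm z)"
    and z: "norm z < R"
  shows "norm (f z - f 0) \<le> g (norm z) - g 0"
proof (cases "z = 0")
  case False
  define u where "u = sgn z"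
  have u: "norm u = 1" "z = of_real (norm z) * u"
    using False by (simp add: u_def norm_sgn) (simp add: u_def sgn_div_norm scaleR_conv_of_real field_simps)
  have F: "((\<lambda>t. f (of_real t * u)) has_vector_derivative u * f' (of_real t * u)) (at t)"
    if "0 \<le> t" "t \<le> norm z" for t
  proof -
    have "((\<lambda>t. of_real t * u) has_vector_derivative u) (at t)"
      by (auto intro!: derivative_eq_intros)
    moreover have "(f has_field_derivative f' (of_real t * u)) (at (of_real t * u))"
      using that z u(1) by (intro f) (simp add: norm_mult)
    ultimately show ?thesis
      using field_vector_diff_chain_at[of "\<lambda>t. of_real t * u"] by (simp add: o_def)
  qed
  have G: "(g has_vector_derivative g' t) (at t)" if "0 \<le> t" "t \<le> norm z" for t
    using g[of t] that z by (simp add: has_real_derivative_iff_has_vector_derivative)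
  have "norm (f (of_real (norm z) * u) - f (of_real 0 * u)) \<le> g (norm z) - g 0"
  proof (rule differentiable_bound_general)
    show "0 < norm z" using False by simp
    show "continuous_on {0..norm z} (\<lambda>t. f (of_real t * u))"
      by (rule continuous_at_imp_continuous_on) (use F has_vector_derivative_continuous in fastforce)
    show "continuous_on {0..norm z} g"
      by (rule continuous_at_imp_continuous_on) (use G has_vector_derivative_continuous in fastforce)
    show "norm (u * f' (of_real t * u)) \<le> g' t" if "0 < t" "t < norm z" for t
      using le[of "of_real t * u"] that z u(1) by (cases "u = 0") (auto simp: norm_mult)
  qed (use F G in auto)
  then show ?thesis using u(2) by simp
qed simp

text \<open>The squared modulus of \<open>cos z\<close> is \<open>(cos (Re z))\<^sup>2\<close> plus
  the square of \<open>sinh (Im z)\<close>, and the real cosine decreases on \<open>{0..pi}\<close>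
  while \<open>\<bar>Re z\<bar>\<close> is at most \<open>norm z\<close>.\<close>

lemma cos_norm_le_norm_cos:
  fixes z :: complex
  assumes "norm z \<le> pi / 2"
  shows "cos (norm z) \<le> norm (cos z)"
proof -
  have "cos (norm z) \<le> cos \<bar>Re z\<bar>"
    using assms abs_Re_le_cmod[of z] by (intro cos_monotone_0_pi_le) auto
  also have "\<dots> \<le> norm (cos z)"
  proof (rule power2_le_imp_le)
    show "(cos \<bar>Re z\<bar>)\<^sup>2 \<le> (norm (cos z))\<^sup>2"
      unfolding norm_cos_squared cos_abs_real by simp
  qed simp
  finally show ?thesis .
qed

text \<open>By the preceding cosine bound, the derivative \<open>inverse ((cos w)\<^sup>2)\<close>
  is dominated on each circle by its value at the radius, so the real tangent is a radial
  majorant.\<close>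

lemma norm_tan_le:
  fixes z :: complex
  assumes "norm z < pi / 2"
  shows "norm (tan z) \<le> tan (norm z)"
proof -
  have pos: "0 < cos (norm w)" if "norm w < pi / 2" for w :: complex
    using that by (intro cos_gt_zero_pi) (auto intro: less_le_trans[of _ 0])
  have nz: "cos w \<noteq> 0" if "norm w < pi / 2" for w :: complex
    using pos[OF that] cos_norm_le_norm_cos[of w] that by auto
  have "norm (tan z - tan 0) \<le> tan (norm z) - tan 0"
  proof (rule norm_diff_le_radial_majorant)
    show "(tan has_field_derivative inverse ((cos w)\<^sup>2)) (at w)" if "norm w < pi / 2" for w :: complex
      using nz[OF that] by (rule DERIV_tan)
    show "(tan has_real_derivative inverse ((cos t)\<^sup>2)) (at t)" if "0 \<le> t" "t < pi / 2" for t
      using pos[of "of_real t"] that by (intro DERIV_tan) auto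
    show "norm (inverse ((cos w)\<^sup>2)) \<le> inverse ((cos (norm w))\<^sup>2)" if "norm w < pi / 2" for w :: complex
      using pos[OF that] cos_norm_le_norm_cos[of w] that
      by (auto simp: norm_inverse norm_power intro!: le_imp_inverse_le power_mono)
  qed (use assms in auto)
  then show ?thesis by simp
qed

text \<open>The derivative is the reciprocal of a square root of \<open>1 - w\<^sup>2\<close>, whose
  modulus is at least \<open>1 - (norm w)\<^sup>2\<close>; hence the real arcsine is a radial
  majorant.\<close>

lemma norm_Arcsin_le:
  assumes "norm z < 1"
  shows "norm (Arcsin z) \<le> arcsin (norm z)"
proof -
  have "norm (Arcsin z - Arcsin 0) \<le> arcsin (norm z) - arcsin 0"
  proof (rule norm_diff_le_radial_majorant)
    show "(Arcsin has_field_derivative inverse (cos (Arcsin w))) (at w)" if "norm w < 1" for w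
      using abs_Re_le_cmod[of w] that by (intro has_field_derivative_Arcsin) auto
    show "(arcsin has_real_derivative inverse (sqrt (1 - t\<^sup>2))) (at t)" if "0 \<le> t" "t < 1" for t
      using that by (intro DERIV_arcsin) auto
    show "norm (inverse (cos (Arcsin w))) \<le> inverse (sqrt (1 - (norm w)\<^sup>2))" if "norm w < 1" for w
    proof -
      have "1 - (norm w)\<^sup>2 \<le> norm (1 - w\<^sup>2)"
        using norm_triangle_ineq2[of 1 "w\<^sup>2"] by (simp add: norm_power)
      also have "1 - w\<^sup>2 = (cos (Arcsin w))\<^sup>2"
        by (simp add: cos_squared_eq)
      finally have "sqrt (1 - (norm w)\<^sup>2) \<le> norm (cos (Arcsin w))"
        by (intro real_le_lsqrt) (auto simp: norm_power)
      moreover have "(norm w)\<^sup>2 < 1"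
        using that by (simp add: abs_square_less_1)
      ultimately show ?thesis
        by (auto simp: norm_inverse intro!: le_imp_inverse_le)
    qed
  qed (use assms in auto)
  then show ?thesis by simp
qed

lemma Schwarz_Lemma_scaled:
  assumes "f holomorphic_on ball 0 1" "f 0 = 0" "M > 0"
    and "\<And>z. norm z < 1 \<Longrightarrow> norm (f z) < M" and "norm z < 1"
  shows "norm (f z) \<le> M * norm z"
proof -
  have "norm (f z / of_real M) \<le> norm z"
    by (rule Schwarz_Lemma(1)[of "\<lambda>z. f z / of_real M"])
      (use assms in \<open>auto intro!: holomorphic_intros simp: norm_divide\<close>)
  then show ?thesis
    using \<open>M > 0\<close> by (simp add: norm_divide field_simps)
qed

text \<open>This is the cosine at \<open>\<i> * (w / 2)\<close>, a point of modulus below 1/2 and so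
  closer to 0 than the first zero of the cosine.\<close>

lemma cosh_half_nonzero:
  fixes w :: complex
  assumes "norm w < 1"
  shows "cosh (w / 2) \<noteq> 0"
proof -
  have small: "norm (\<i> * (w / 2)) < pi / 2"
    using assms pi_ge_two by (simp add: norm_mult norm_divide)
  then have "0 < cos (norm (\<i> * (w / 2)))"
    by (intro cos_gt_zero_pi) (auto intro: less_le_trans[of _ 0])
  then show ?thesis
    using cos_norm_le_norm_cos[of "\<i> * (w / 2)"] small by (auto simp: cosh_conv_cos)
qed

text \<open>With \<open>E = exp (w / 2)\<close> both sides equal
  \<open>2 * E\<^sup>2 / (E\<^sup>2 + 1)\<close>. At a zero of the denominator, division by zero
  would give 0 on the left and 1 on the right.\<close>

lemma sigmoid_conv_tanh:
  fixes w :: complex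
  assumes "cosh (w / 2) \<noteq> 0"
  shows "2 / (1 + exp (- w)) = 1 + tanh (w / 2)"
proof -
  define E where "E = exp (w / 2)"
  have E: "E \<noteq> 0" "exp (- (w / 2)) = inverse E" "exp (- w) = inverse E * inverse E"
    by (simp_all add: E_def exp_minus[symmetric] exp_add[symmetric])
  have "E + inverse E \<noteq> 0"
    using assms E(2) by (auto simp: cosh_field_def E_def)
  then have nz: "E * E + 1 \<noteq> 0"
    using E(1) by (auto simp: field_simps)
  have "E + inverse E = (E * E + 1) / E" "E - inverse E = (E * E - 1) / E"
    "1 + inverse E * inverse E = (E * E + 1) / (E * E)"
    using E(1) by (simp_all add: field_simps)
  then show ?thesis
    unfolding tanh_altdef E(2,3) E_def[symmetric] using E(1) nz by (simp add: add_divide_eq_iff)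
qed

text \<open>Up to a unimodular factor this is the tangent at \<open>\<i> * (w / 2)\<close>, so its
  modulus stays below \<open>tan (1 / 2)\<close>; the Schwarz lemma then supplies the factor
  \<open>norm w\<close>.\<close>

lemma norm_tanh_half_le:
  fixes w :: complex
  assumes "norm w < 1"
  shows "norm (tanh (w / 2)) \<le> tan (1 / 2) * norm w"
proof (rule Schwarz_Lemma_scaled[OF _ _ _ _ assms])
  have small: "norm (\<i> * (w / 2)) < pi / 2" if "norm w < 1" for w :: complex
    using that pi_ge_two by (simp add: norm_mult norm_divide)
  show "(\<lambda>w. tanh (w / 2 :: complex)) holomorphic_on ball 0 1"
    unfolding tanh_def using cosh_half_nonzero
    by (auto simp: sinh_def cosh_def intro!: holomorphic_intros)
  show "0 < tan (1 / 2 :: real)"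
    using pi_ge_two by (intro tan_gt_zero) auto
  show "norm (tanh (w / 2)) < tan (1 / 2)" if w: "norm w < 1" for w :: complex
  proof -
    have "norm (tanh (w / 2)) = norm (tan (\<i> * (w / 2)))"
      by (simp add: tanh_conv_tan norm_mult)
    also have "\<dots> \<le> tan (norm (\<i> * (w / 2)))"
      using small[OF w] by (rule norm_tan_le)
    also have "norm (\<i> * (w / 2)) = norm w / 2"
      by (simp add: norm_mult norm_divide)
    also have "tan (norm w / 2) < tan (1 / 2)"
      using w pi_ge_two by (intro tan_monotone) (auto intro: less_le_trans[of _ 0])
    finally show ?thesis .
  qed
qed simp

text \<open>Integrating factor: for \<open>a = \<beta>1 / \<beta>2\<close>, the derivative of
  \<open>t powr a * v (t * z)\<close> in \<open>t\<close> is
  \<open>t powr (a - 1) / \<beta>2\<close> times the bounded expression at \<open>t * z\<close>.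
  Integrating over \<open>{0..1}\<close> gives the constant
  \<open>1 / (\<beta>2 * a) = 1 / \<beta>1\<close>.\<close>

lemma norm_le_of_Euler_equation_bound:
  fixes v :: "complex \<Rightarrow> complex"
  assumes v: "v holomorphic_on ball 0 1" and \<beta>: "\<beta>1 > 0" "\<beta>2 > 0"
    and bound: "\<And>z. z \<noteq> 0 \<Longrightarrow> norm z < 1 \<Longrightarrow>
      norm (of_real \<beta>1 * v z + of_real \<beta>2 * z * deriv v z) \<le> T"
    and z: "z \<noteq> 0" "norm z < 1"
  shows "norm (v z) \<le> T / \<beta>1"
proof -
  define a where "a = \<beta>1 / \<beta>2"
  have a: "a > 0" using \<beta> by (simp add: a_def)
  define f' where "f' t = of_real (t powr (a - 1) / \<beta>2) *
    (of_real \<beta>1 * v (of_real t * z) + of_real \<beta>2 * (of_real t * z) * deriv v (of_real t * z))" for t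
  have in_ball: "norm (of_real t * z) < 1" if "0 \<le> t" "t \<le> 1" for t
  proof -
    have "norm (of_real t * z) \<le> norm z"
      using that mult_left_le_one_le[of "norm z" t] by (simp add: norm_mult)
    then show ?thesis using z(2) by (rule le_less_trans)
  qed
  \<comment> \<open>Since \<open>0 powr a = 0\<close>, the terms at 0 vanish and this is the claim.
    Positivity of \<open>a\<close> makes both functions continuous at 0.\<close>
  have "norm (of_real (1 powr a) * v (of_real 1 * z) - of_real (0 powr a) * v (of_real 0 * z))
      \<le> 1 powr a * T / \<beta>1 - 0 powr a * T / \<beta>1"
  proof (rule differentiable_bound_general[where f = "\<lambda>t. of_real (t powr a) * v (of_real t * z)"
        and f' = f' and \<phi>' = "\<lambda>t. t powr (a - 1) * T / \<beta>2"])
    have "continuous_on {0..1} (\<lambda>t. v (of_real t * z))"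
      by (rule continuous_on_compose2[OF holomorphic_on_imp_continuous_on[OF v]])
        (use in_ball in \<open>auto intro!: continuous_intros\<close>)
    then show "continuous_on {0..1} (\<lambda>t. of_real (t powr a) * v (of_real t * z))"
      using a by (intro continuous_intros continuous_on_powr') auto
    show "continuous_on {0..1} (\<lambda>t. t powr a * T / \<beta>1)"
      using a \<beta> by (intro continuous_intros continuous_on_powr') auto
    fix t :: real assume t: "0 < t" "t < 1"
    have powr_t: "t powr a = t * t powr (a - 1)"
      using t by (simp add: powr_mult_base)
    have P: "((\<lambda>t. t powr a) has_real_derivative a * t powr (a - 1)) (at t)"
      using t by (intro has_real_derivative_powr)
    have "((\<lambda>t. of_real t * z) has_vector_derivative z) (at t)"
      by (auto intro!: derivative_eq_intros)
    moreover have "(v has_field_derivative deriv v (of_real t * z)) (at (of_real t * z))"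
      using in_ball[of t] t by (intro holomorphic_derivI[OF v]) auto
    ultimately have V: "((\<lambda>t. v (of_real t * z)) has_vector_derivative z * deriv v (of_real t * z)) (at t)"
      using field_vector_diff_chain_at[of "\<lambda>t. of_real t * z"] by (simp add: o_def)
    have "((\<lambda>t. t powr a *\<^sub>R v (of_real t * z)) has_vector_derivative
        t powr a *\<^sub>R (z * deriv v (of_real t * z)) + (a * t powr (a - 1)) *\<^sub>R v (of_real t * z)) (at t)"
      using P V by (rule has_vector_derivative_scaleR)
    moreover have "t powr a *\<^sub>R (z * deriv v (of_real t * z)) + (a * t powr (a - 1)) *\<^sub>R v (of_real t * z) = f' t"
      unfolding f'_def powr_t using \<beta> by (simp add: scaleR_conv_of_real a_def field_simps)
    ultimately show "((\<lambda>t. of_real (t powr a) * v (of_real t * z)) has_vector_derivative f' t) (at t)"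
      by (simp add: scaleR_conv_of_real)
    show "((\<lambda>t. t powr a * T / \<beta>1) has_vector_derivative t powr (a - 1) * T / \<beta>2) (at t)"
      unfolding has_real_derivative_iff_has_vector_derivative[symmetric]
      using \<beta> t by (auto intro!: derivative_eq_intros simp: a_def)
    have "norm (f' t) = t powr (a - 1) / \<beta>2 *
        norm (of_real \<beta>1 * v (of_real t * z) + of_real \<beta>2 * (of_real t * z) * deriv v (of_real t * z))"
      unfolding f'_def using \<beta> by (simp only: norm_mult norm_of_real) simp
    also have "\<dots> \<le> t powr (a - 1) / \<beta>2 * T"
      using bound[of "of_real t * z"] in_ball[of t] t z \<beta> by (intro mult_left_mono) auto
    finally show "norm (f' t) \<le> t powr (a - 1) * T / \<beta>2" by simp
  qed simp
  then show ?thesis by simp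
qed

text \<open>By the double-angle formulas \<open>tan (1 / 2)\<close> is a root. The roots sum to
  \<open>- 2 * cot 1 < 0\<close>, so two positive roots cannot differ.\<close>

lemma r0_eq_tan_half:
  fixes r :: real
  assumes "r > 0" "r\<^sup>2 + 2 * cot 1 * r - 1 = 0"
  shows "r = tan (1 / 2)"
proof -
  define T where "T = tan (1 / 2 :: real)"
  have T: "T > 0"
    unfolding T_def using pi_ge_two by (intro tan_gt_zero) auto
  have cos1: "cos 1 > (0::real)" and cosh: "cos (1 / 2) > (0::real)"
    using pi_half_gt_zero pi_gt3 by (auto intro!: cos_gt_zero)
  have cot: "cot 1 = cos 1 / (sin 1 :: real)" by (simp add: cot_def)
  have s: "sin 1 = 2 * sin (1 / 2) * cos (1 / 2 :: real)" using sin_double[of "1 / 2 :: real"] by simp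
  have c: "cos 1 = (cos (1 / 2))\<^sup>2 - (sin (1 / 2 :: real))\<^sup>2" using cos_double[of "1 / 2 :: real"] by simp
  have sh: "sin (1 / 2) > (0::real)" using pi_ge_two by (intro sin_gt_zero) auto
  have "T\<^sup>2 + 2 * cot 1 * T - 1 = 0"
    unfolding T_def tan_def cot s c using sh cosh by (simp add: field_simps power2_eq_square)
  with assms(2) have "(r - T) * (r + T + 2 * cot 1) = 0"
    by (simp add: algebra_simps power2_eq_square)
  moreover have "cot 1 > (0::real)"
    unfolding cot s using cos1 sh cosh by simp
  ultimately show ?thesis
    using assms(1) T by (auto simp: T_def)
qed

theorem theorem2p4:
  fixes \<nu>0 \<nu>1 r0 \<beta>1 \<beta>2 :: real and p :: "complex \<Rightarrow> complex"
  assumes "\<nu>0 = sqrt (1 - (sin 1)\<^sup>2)"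
    and "\<nu>1 = - (sin 2 / (1 + cos 2))"
    and "r0 > 0" and "r0\<^sup>2 + 2 * cot 1 * r0 - 1 = 0"
    and "\<beta>1 > 0" and "\<beta>2 > 0"
    and "\<nu>0 * (\<beta>1 + \<beta>2 * \<nu>1) \<ge> r0"
    and "p analytic_on ball 0 1" and "p 0 = 1"
    and "subordinate
           (\<lambda>z. 1 + complex_of_real \<beta>1 * z * deriv p z + complex_of_real \<beta>2 * z\<^sup>2 * deriv (deriv p) z)
           (\<lambda>z. 2 / (1 + exp (- z)))"
  shows "subordinate p (\<lambda>z. 1 + sin z)"
proof -
  have half_pi: "1 < pi / 2" using pi_gt3 by simp
  have cos1: "cos 1 > (0::real)" using half_pi by (intro cos_gt_zero) auto
  have \<nu>0: "\<nu>0 = cos 1"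
    using assms(1) cos1 by (simp add: cos_squared_eq[symmetric])
  have "\<nu>1 = - tan 1"
    using assms(2) tan_half[of "1 :: real"] by (simp add: add.commute)
  moreover have "tan 1 > (0::real)"
    using half_pi by (intro tan_gt_zero) auto
  ultimately have "\<nu>0 * (\<beta>1 + \<beta>2 * \<nu>1) \<le> cos 1 * \<beta>1"
    using cos1 \<open>\<beta>2 > 0\<close> by (simp add: \<nu>0)
  then have M: "tan (1 / 2) / \<beta>1 \<le> cos 1"
    using assms(3-7) r0_eq_tan_half[of r0] by (simp add: field_simps)
  have p: "p holomorphic_on ball 0 1"
    using assms(8) by (rule analytic_imp_holomorphic)
  then have p': "deriv p holomorphic_on ball 0 1"
    by (intro holomorphic_deriv) auto

  obtain \<omega> where \<omega>: "\<And>z. norm z < 1 \<Longrightarrow> norm (\<omega> z) \<le> norm z"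
    and eq: "\<And>z. norm z < 1 \<Longrightarrow> 1 + complex_of_real \<beta>1 * z * deriv p z + complex_of_real \<beta>2 * z\<^sup>2 * deriv (deriv p) z
      = 2 / (1 + exp (- \<omega> z))"
    using assms(10) unfolding subordinate_def by (elim exE conjE) (blast intro: that mem_ball_0[THEN iffD2])
  \<comment> \<open>Removing the constant 1 leaves \<open>z\<close> times this expression equal to
    \<open>tanh (\<omega> z / 2)\<close>; the factor \<open>norm z\<close> cancels against
    \<open>norm (\<omega> z) \<le> norm z\<close>.\<close>
  have Euler: "norm (of_real \<beta>1 * deriv p z + of_real \<beta>2 * z * deriv (deriv p) z) \<le> tan (1 / 2)"
    if z: "z \<noteq> 0" "norm z < 1" for z
  proof -
    have \<omega>z: "norm (\<omega> z) < 1" using \<omega>[OF z(2)] z(2) by linarith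
    have "z * (of_real \<beta>1 * deriv p z + of_real \<beta>2 * z * deriv (deriv p) z) = tanh (\<omega> z / 2)"
      using eq[OF z(2)] sigmoid_conv_tanh[OF cosh_half_nonzero[OF \<omega>z]]
      by (simp add: algebra_simps power2_eq_square)
    then have "norm z * norm (of_real \<beta>1 * deriv p z + of_real \<beta>2 * z * deriv (deriv p) z)
        = norm (tanh (\<omega> z / 2))"
      by (metis norm_mult)
    also have "\<dots> \<le> tan (1 / 2) * norm (\<omega> z)"
      using \<omega>z by (rule norm_tanh_half_le)
    also have "\<dots> \<le> norm z * tan (1 / 2)"
      using \<omega>[OF z(2)] tan_gt_zero[of "1 / 2"] half_pi by (simp add: mult.commute)
    finally show ?thesis
      using z(1) by simp
  qed
  have deriv_le: "norm (deriv p z) \<le> cos 1" if "z \<noteq> 0" "norm z < 1" for z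
    using norm_le_of_Euler_equation_bound[OF p' \<open>\<beta>1 > 0\<close> \<open>\<beta>2 > 0\<close> Euler that] M by linarith
  have q_le: "norm (p z - 1) \<le> cos 1 * norm z" if "norm z < 1" for z
  proof -
    have "norm (p z - p 0) \<le> cos 1 * norm z - cos 1 * 0"
      by (rule norm_diff_le_radial_majorant[where R = 1 and f' = "deriv p" and g' = "\<lambda>_. cos 1"])
        (use that deriv_le in \<open>auto intro!: derivative_eq_intros holomorphic_derivI[OF p]\<close>)
    then show ?thesis using \<open>p 0 = 1\<close> by simp
  qed
  have q_less: "norm (p z - 1) < cos 1" if "norm z < 1" for z
    using q_le[OF that] that cos1 by (meson le_less_trans mult_less_cancel_left2 not_le)
  have q_less1: "norm (p z - 1) < 1" if "norm z < 1" for z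
    using q_less[OF that] cos_le_one[of "1 :: real"] by linarith

  \<comment> \<open>The sine undoes \<open>Arcsin\<close> at every complex number, and this branch
    vanishes at 0.\<close>
  define w where "w z = Arcsin (p z - 1)" for z
  have w_less: "norm (w z) < 1" if "norm z < 1" for z
  proof -
    have "norm (w z) \<le> arcsin (norm (p z - 1))"
      unfolding w_def using q_less1[OF that] by (rule norm_Arcsin_le)
    \<comment> \<open>Here \<open>cos 1\<close> is rewritten as \<open>sin (pi / 2 - 1)\<close>,
      which \<open>arcsin\<close> inverts; that the result is below 1 amounts to
      \<open>pi < 4\<close>.\<close>
    also have "\<dots> \<le> arcsin (sin (pi / 2 - 1))"
      using q_less[OF that] by (intro arcsin_le_arcsin) (auto simp: cos_sin_eq intro: order_trans[of _ 0])
    also have "\<dots> = pi / 2 - 1"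
      using half_pi by (intro arcsin_sin) auto
    also have "\<dots> < 1"
      using pi_less_4 by simp
    finally show ?thesis .
  qed
  have w_hol: "w holomorphic_on ball 0 1"
  proof -
    \<comment> \<open>The branch cuts lie on the real axis at distance at least 1 from 0.\<close>
    have "Arcsin holomorphic_on ball 0 1"
      by (rule holomorphic_on_Arcsin) (simp add: le_less_trans[OF abs_Re_le_cmod])
    then have "Arcsin \<circ> (\<lambda>z. p z - 1) holomorphic_on ball 0 1"
      by (rule holomorphic_on_compose_gen[rotated]) (use q_less1 p in \<open>auto intro!: holomorphic_intros\<close>)
    then show ?thesis by (simp add: w_def[abs_def] o_def)
  qed
  have w0: "w 0 = 0" using \<open>p 0 = 1\<close> by (simp add: w_def)
  have "norm (w z) \<le> norm z" if "norm z < 1" for z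
    using Schwarz_Lemma(1)[OF w_hol w0 w_less that] .
  moreover have "p z = 1 + sin (w z)" for z
    by (simp add: w_def)
  ultimately show ?thesis
    unfolding subordinate_def using w_hol w0 by (auto simp: analytic_on_open)
qed

end
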